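(* Let $\mathcal{X}^\ast\in\mathbb{R}^{n\times\cdots\times n}$ ($d$ modes) be a tensor of HOSVD rank $\mathbf r=(r,\dots,r)$ (or CP rank $r$). Let $\mathbf{A}\in\mathbb{R}^{m\times n^d}$ be the matrix of a linear measurement operator $\mathcal{A}(\mathcal{X})=\mathbf{A}\,\mathrm{Vec}(\mathcal{X})$, and let the TrimTIHT algorithm be applied to the measurements $\mathbf b=\mathcal{A}(\mathcal{X}^\ast)$ with step sizes $\mu_t>0$, producing iterates $\mathcal{X}^t,\mathcal{Y}^t$ and trimmed matrices $\mathbf{A}_t$. Let $\mathcal{R}^t=\mathcal{X}^t-\mathcal{X}^\ast$ be the residuals and $\mathbf r^t=\mathrm{Vec}(\mathcal{R}^t)$. Define $$\Delta_t=\frac{\|\mathbf{A}_t\mathbf r^t\|_2^2}{\|\mathbf r^t\|_2^2}\ \ (\text{for any } t\ge 1),\qquad \rho_t=\frac{\|\mathbf{A}_t\mathbf u_t\|_2^2}{\|\mathbf u_t\|_2^2},\quad\text{where }\ \mathbf u_t=P_{\Omega_t}(\mathbf{A}_t^T\mathbf{A}_t\mathbf r^t),\ \ \Omega_t=\mathrm{span}\{\mathbf r^t,\mathbf r^{t+1}\},$$ with $P_{\Omega_t}$ the orthogonal projection onto the linear subspace $\Omega_t$ (assume $\mathbf r^t\neq 0$ and $\mathbf u_t\ne 0$, so that these quotients are defined), and let $\xi_t\ge 0$ be such that $$\|\mathcal{X}^{t+1}-\mathcal{Y}^t\|_F\le(1+\xi_t)\,\|\mathcal{Y}^t-\mathcal{X}^\ast\|_F.$$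 Then $$\|\mathcal{R}^{t+1}\|_F\le\left(2\sqrt{1-(2-\mu_t\rho_t)\mu_t\Delta_t}+\sqrt{2\xi_t+\xi_t^2}\,\left(1+\mu_t\|\mathbf{A}_t\|_2\sqrt{\Delta_t}\right)\right)^{t+1}\|\mathcal{R}^0\|_F.$$
   Context: $\mathrm{Vec}$ denotes the vectorization of a tensor, $\|\mathcal{X}\|_F=\|\mathrm{Vec}(\mathcal{X})\|_2$, and $\|\cdot\|_2$ of a matrix is the operator norm. TrimTIHT algorithm: let $\mathbf a_i^T$ be the rows of $\mathbf{A}$, let $m_{\mathrm{trim}}$ with $0\le m_{\mathrm{trim}}<m$ be the number of trimmed rows, and let $T_{\mathbf r}$ be a low-rank approximation (thresholding) operator, returning a tensor of HOSVD rank at most $\mathbf r$ (respectively CP rank at most $r$). Start from the initial tensor $\mathcal{X}^0=0$. At iteration $t$: compute $y_i=|\mathbf a_i^T\mathrm{Vec}(\mathcal{X}^t)-b_i|$ for $i=1,\dots,m$; let $\Theta_t$ be the set of indices of the $m-m_{\mathrm{trim}}$ smallest values $y_i$; put $$\mathbf{A}_t=\sqrt{\tfrac{m}{m-m_{\mathrm{trim}}}}\,\mathbf{A}[\Theta_t,:],\qquad \mathbf b_t=\sqrt{\tfrac{m}{m-m_{\mathrm{trim}}}}\,\mathbf b[\Theta_t]$$ (restriction to the rows/entries in $\Theta_t$); then set $$\mathrm{Vec}(\mathcal{Y}^t)=\mathrm{Vec}(\mathcal{X}^t)+\mu_t\mathbf{A}_t^T(\mathbf b_t-\mathbf{A}_t\mathrm{Vec}(\mathcal{X}^t)),\qquad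 \mathcal{X}^{t+1}=T_{\mathbf r}(\mathcal{Y}^t).$$ CP rank $r$: sum of $r$ rank-one tensors (outer products of vectors). HOSVD rank $(r_1,\dots,r_d)$: given by the dimensions of the core in a Tucker decomposition $\mathcal{C}\times_1\mathbf U_1\cdots\times_d\mathbf U_d$ whose factor matrices $\mathbf U_i$ have orthonormal columns.
   Formalization: The displayed bound with the iteration-t factor to the power t+1 fails for varying step sizes; what is proved is the bound by the product of the factors of iterations 0,…,t, and by the largest of these factors to the power t+1 (Δ_0 is included). *)

theory Defs
  imports "HOL-Analysis.Analysis"
begin

text \<open>
  A tensor with \<open>d\<close> modes, each of size \<open>n\<close>, assigns a real number to every multi-index;
  here \<open>d = CARD('d)\<close> and \<open>n = CARD('n)\<close>. The \<open>n^d\<close> coordinates of a vectorized tensor are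
  indexed by the multi-indices themselves, so no ordering of them has to be chosen.
\<close>

type_synonym ('d, 'n) tensor = "('d \<Rightarrow> 'n) \<Rightarrow> real"

definition Vec :: "('d::finite, 'n::finite) tensor \<Rightarrow> real ^ ('d \<Rightarrow> 'n)" where
  "Vec X = (\<chi> i. X i)"

definition frob_norm :: "('d::finite, 'n::finite) tensor \<Rightarrow> real" where
  "frob_norm X = norm (Vec X)"

text \<open>
  \<open>X = C \<times>\<^sub>1 U\<^sub>1 \<dots> \<times>\<^sub>d U\<^sub>d\<close> with a core \<open>C\<close> of dimensions \<open>rs 1, \<dots>, rs d\<close>;
  \<open>U k a\<close> is column \<open>a\<close> of the factor matrix of mode \<open>k\<close>. Minimality of the core
  is not required.
\<close>

definition has_hosvd_rank :: "('d::finite \<Rightarrow> nat) \<Rightarrow> ('d, 'n::finite) tensor \<Rightarrow> bool" where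
  "has_hosvd_rank rs X \<longleftrightarrow>
     (\<exists>(C :: ('d \<Rightarrow> nat) \<Rightarrow> real) (U :: 'd \<Rightarrow> nat \<Rightarrow> real ^ 'n).
        (\<forall>k. \<forall>a<rs k. \<forall>b<rs k. U k a \<bullet> U k b = (if a = b then 1 else 0)) \<and>
        (\<forall>i. X i = (\<Sum>j \<in> (\<Pi>\<^sub>E k\<in>UNIV. {..<rs k}). C j * (\<Prod>k\<in>UNIV. U k (j k) $ i k))))"

definition hosvd_rank_at_most :: "('d::finite \<Rightarrow> nat) \<Rightarrow> ('d, 'n::finite) tensor \<Rightarrow> bool" where
  "hosvd_rank_at_most rs X \<longleftrightarrow> (\<exists>rs'. (\<forall>k. rs' k \<le> rs k) \<and> has_hosvd_rank rs' X)"

definition outer_product :: "('d::finite \<Rightarrow> real ^ 'n::finite) \<Rightarrow> ('d, 'n) tensor" where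
  "outer_product v = (\<lambda>i. \<Prod>k\<in>UNIV. v k $ i k)"

definition has_cp_rank :: "nat \<Rightarrow> ('d::finite, 'n::finite) tensor \<Rightarrow> bool" where
  "has_cp_rank r X \<longleftrightarrow>
     (\<exists>v :: nat \<Rightarrow> 'd \<Rightarrow> real ^ 'n. \<forall>i. X i = (\<Sum>l<r. outer_product (v l) i))"

definition cp_rank_at_most :: "nat \<Rightarrow> ('d::finite, 'n::finite) tensor \<Rightarrow> bool" where
  "cp_rank_at_most r X \<longleftrightarrow> (\<exists>r'\<le>r. has_cp_rank r' X)"

text \<open>Ties are allowed to be broken in any way.\<close>

definition smallest_indices :: "nat \<Rightarrow> ('m::finite \<Rightarrow> real) \<Rightarrow> 'm set \<Rightarrow> bool" where
  "smallest_indices k y S \<longleftrightarrow> card S = k \<and> (\<forall>i\<in>S. \<forall>j. j \<notin> S \<longrightarrow> y i \<le> y j)"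

text \<open>
  \<open>sqrt (m / (m - mtrim))\<close> times the restriction of a matrix, or of a vector, to the rows in
  \<open>range \<sigma>\<close>. The row indices of the restriction form a type \<open>'k\<close>, and \<open>\<sigma>\<close> enumerates the
  selected rows by it.
\<close>

definition trim_rows ::
  "nat \<Rightarrow> ('k::finite \<Rightarrow> 'm::finite) \<Rightarrow> ('a::real_vector) ^ 'm \<Rightarrow> 'a ^ 'k" where
  "trim_rows mtrim \<sigma> M =
     sqrt (real CARD('m) / real (CARD('m) - mtrim)) *\<^sub>R (\<chi> k. M $ \<sigma> k)"

text \<open>
  The sequences \<open>X\<close>, \<open>Y\<close> are a run of TrimTIHT in which \<open>\<Theta> t\<close> is the set of rows kept at
  iteration \<open>t\<close>, enumerated by \<open>\<sigma> t\<close>. The bijection forces \<open>CARD('k) = CARD('m) - mtrim\<close>.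
\<close>

definition trim_tiht ::
  "real ^ ('d::finite \<Rightarrow> 'n::finite) ^ 'm::finite \<Rightarrow> real ^ 'm \<Rightarrow> nat \<Rightarrow>
   (('d, 'n) tensor \<Rightarrow> ('d, 'n) tensor) \<Rightarrow> (nat \<Rightarrow> real) \<Rightarrow>
   (nat \<Rightarrow> 'm set) \<Rightarrow> (nat \<Rightarrow> 'k::finite \<Rightarrow> 'm) \<Rightarrow>
   (nat \<Rightarrow> ('d, 'n) tensor) \<Rightarrow> (nat \<Rightarrow> ('d, 'n) tensor) \<Rightarrow> bool" where
  "trim_tiht A b mtrim T \<mu> \<Theta> \<sigma> X Y \<longleftrightarrow>
     X 0 = (\<lambda>_. 0) \<and>
     (\<forall>t. smallest_indices (CARD('m) - mtrim) (\<lambda>i. \<bar>A $ i \<bullet> Vec (X t) - b $ i\<bar>) (\<Theta> t) \<and>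
          bij_betw (\<sigma> t) UNIV (\<Theta> t) \<and>
          (let At = trim_rows mtrim (\<sigma> t) A; bt = trim_rows mtrim (\<sigma> t) b
           in Vec (Y t) = Vec (X t) + \<mu> t *\<^sub>R (transpose At *v (bt - At *v Vec (X t)))) \<and>
          X (Suc t) = T (Y t))"

definition orth_proj :: "('a::euclidean_space) set \<Rightarrow> 'a \<Rightarrow> 'a" where
  "orth_proj S v = (THE p. p \<in> S \<and> (\<forall>s\<in>S. orthogonal (v - p) s))"

end

theory Submission
  imports Defs
begin

text \<open>
  Write \<open>M = A\<^sub>t\<close>, \<open>x = r\<^sup>t\<close>, \<open>x' = r\<^sup>t\<^sup>+\<^sup>1\<close>. Since the measurements are exact,
  \<open>w = Vec (Y\<^sup>t - X\<^sup>*)\<close> equals \<open>x - \<mu> M\<^sup>T M x\<close>. Squaring \<open>\<parallel>x' - w\<parallel> \<le> (1 + \<xi>) \<parallel>w\<parallel>\<close> and replacing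
  \<open>w\<close> in \<open>x' \<bullet> w\<close> by its projection \<open>x - \<mu> u\<close> onto \<open>span {x, x'}\<close> gives
  \<open>\<parallel>x'\<parallel>\<^sup>2 \<le> 2 \<parallel>x'\<parallel> \<parallel>x - \<mu> u\<parallel> + (2 \<xi> + \<xi>\<^sup>2) \<parallel>w\<parallel>\<^sup>2\<close>, hence
  \<open>\<parallel>x'\<parallel> \<le> 2 \<parallel>x - \<mu> u\<parallel> + sqrt (2 \<xi> + \<xi>\<^sup>2) \<parallel>w\<parallel>\<close>. Finally \<open>x \<bullet> u = \<parallel>M x\<parallel>\<^sup>2 = \<Delta> \<parallel>x\<parallel>\<^sup>2\<close>, and
  \<open>\<parallel>u\<parallel>\<^sup>2 = M u \<bullet> M x\<close> with Cauchy-Schwarz gives \<open>\<parallel>u\<parallel>\<^sup>2 \<le> \<rho> \<Delta> \<parallel>x\<parallel>\<^sup>2\<close>, which bounds \<open>\<parallel>x - \<mu> u\<parallel>\<close>.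
\<close>

lemma Vec_diff: "Vec (X - Y) = Vec X - Vec Y"
  by (simp add: Vec_def vec_eq_iff)

text \<open>\<open>orth_proj\<close> is a definite description, so these facts need existence and
  uniqueness. Two candidates differ by an element of the span that is orthogonal to itself, hence
  zero.\<close>

lemma orth_proj_span:
  fixes v :: "'a::euclidean_space"
  shows orth_proj_in_span: "orth_proj (span B) v \<in> span B"
    and inner_orth_proj_span: "s \<in> span B \<Longrightarrow> s \<bullet> orth_proj (span B) v = s \<bullet> v"
proof -
  let ?P = "\<lambda>p. p \<in> span B \<and> (\<forall>s\<in>span B. orthogonal (v - p) s)"
  obtain p z where "p \<in> span B" "\<And>w. w \<in> span B \<Longrightarrow> orthogonal z w" "v = p + z"
    using orthogonal_subspace_decomp_exists[of B v] by metis
  then have p: "?P p" by simp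
  have "q = p" if q: "?P q" for q
  proof -
    have "p - q \<in> span B" using p q by (simp add: span_diff)
    then have "(v - p) \<bullet> (p - q) = 0" "(v - q) \<bullet> (p - q) = 0"
      using p q by (auto simp: orthogonal_def)
    then have "(p - q) \<bullet> (p - q) = 0" by (simp add: inner_diff_left)
    then show ?thesis by simp
  qed
  with p have P: "?P (orth_proj (span B) v)"
    unfolding orth_proj_def by (rule theI)
  then show "orth_proj (span B) v \<in> span B" by blast
  show "s \<bullet> orth_proj (span B) v = s \<bullet> v" if "s \<in> span B"
    using P that by (simp add: orthogonal_def inner_diff_left inner_commute[of s])
qed

text \<open>Selecting and scaling rows commutes with \<open>A *v z\<close>. With exact measurements
  the trimmed data residual is thus the trimmed matrix applied to the error.\<close>

lemma trim_rows_residual: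
  fixes A :: "real ^ 'n::finite ^ 'm::finite" and \<sigma> :: "'k::finite \<Rightarrow> 'm"
  shows "trim_rows k \<sigma> (A *v z) - trim_rows k \<sigma> A *v x = trim_rows k \<sigma> A *v (z - x)"
proof -
  have "trim_rows k \<sigma> (A *v z) = trim_rows k \<sigma> A *v z"
    by (simp add: trim_rows_def vec_eq_iff matrix_vector_mult_def sum_distrib_left mult.assoc)
  then show ?thesis by (simp add: matrix_vector_mult_diff_distrib)
qed

text \<open>Complete the square, then use
  \<open>a\<^sup>2 + b\<^sup>2 \<le> (a + b)\<^sup>2\<close>.\<close>

lemma le_of_square_le_linear:
  fixes x a b :: real
  assumes "x\<^sup>2 \<le> 2 * x * a + b\<^sup>2" "0 \<le> a" "0 \<le> b"
  shows "x \<le> 2 * a + b"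
proof -
  have "(x - a)\<^sup>2 \<le> a\<^sup>2 + b\<^sup>2"
    using assms(1) by (simp add: power2_eq_square algebra_simps)
  also have "\<dots> \<le> (a + b)\<^sup>2"
    using assms(2,3) by (simp add: power2_eq_square algebra_simps)
  finally have "x - a \<le> a + b"
    by (rule power2_le_imp_le) (use assms in simp)
  then show ?thesis by simp
qed

text \<open>For \<open>g = transpose M *v y\<close>, moving the transpose across gives
  \<open>g \<bullet> g = (M *v g) \<bullet> y\<close>. Cauchy-Schwarz and one cancelled factor
  \<open>norm g\<close> leave the operator norm of \<open>M\<close> itself.\<close>

lemma norm_transpose_matrix_vector_le:
  fixes M :: "real ^ 'n::finite ^ 'k::finite"
  shows "norm (transpose M *v y) \<le> onorm ((*v) M) * norm y"
proof -
  let ?g = "transpose M *v y"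
  have "(norm ?g)\<^sup>2 = (M *v ?g) \<bullet> y"
    by (simp add: power2_norm_eq_inner transpose_matrix_vector dot_lmul_matrix inner_commute)
  also have "\<dots> \<le> norm (M *v ?g) * norm y"
    by (rule norm_cauchy_schwarz)
  also have "\<dots> \<le> onorm ((*v) M) * norm ?g * norm y"
    by (intro mult_right_mono onorm matrix_vector_mul_bounded_linear norm_ge_zero)
  finally have *: "norm ?g * norm ?g \<le> (onorm ((*v) M) * norm y) * norm ?g"
    by (simp add: power2_eq_square mult_ac)
  have "0 \<le> onorm ((*v) M)"
    by (simp add: onorm_pos_le matrix_vector_mul_bounded_linear)
  with * show ?thesis
    by (cases "?g = 0") auto
qed

text \<open>One iteration: \<open>x\<close>, \<open>x'\<close>, \<open>w\<close> stand for
  \<open>res s\<close>, \<open>res (Suc s)\<close>, \<open>Vec (Y s) - Vec Xstar\<close>, and the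
  thresholding enters through \<open>near\<close>.\<close>

lemma trimmed_step_contraction:
  fixes M :: "real ^ 'n::finite ^ 'k::finite" and x x' w :: "real ^ 'n"
  defines "u \<equiv> orth_proj (span {x, x'}) (transpose M *v (M *v x))"
    and "\<Delta> \<equiv> (norm (M *v x))\<^sup>2 / (norm x)\<^sup>2"
  defines "\<rho> \<equiv> (norm (M *v u))\<^sup>2 / (norm u)\<^sup>2"
  assumes x: "x \<noteq> 0"
    and \<mu>: "0 \<le> \<mu>" and \<xi>: "0 \<le> \<xi>"
    and w: "w = x - \<mu> *\<^sub>R (transpose M *v (M *v x))"
    and near: "norm (x' - w) \<le> (1 + \<xi>) * norm w"
  shows "norm x' \<le> (2 * sqrt (1 - (2 - \<mu> * \<rho>) * \<mu> * \<Delta>) +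
           sqrt (2 * \<xi> + \<xi>\<^sup>2) * (1 + \<mu> * onorm ((*v) M) * sqrt \<Delta>)) * norm x"
proof -
  define g where "g = transpose M *v (M *v x)"
  define e where "e = 2 * \<xi> + \<xi>\<^sup>2"
  have e: "0 \<le> e" using \<xi> by (simp add: e_def)
  have inner_g: "z \<bullet> g = (M *v z) \<bullet> (M *v x)" for z
    unfolding g_def transpose_matrix_vector by (metis dot_lmul_matrix inner_commute)
  have inner_u: "z \<bullet> u = z \<bullet> g" if "z \<in> span {x, x'}" for z
    using inner_orth_proj_span[OF that] by (simp add: u_def g_def)
  have x_span: "x \<in> span {x, x'}" and x'_span: "x' \<in> span {x, x'}"
    by (auto intro: span_base)
  have u_span: "u \<in> span {x, x'}"
    unfolding u_def by (rule orth_proj_in_span)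
  have \<Delta>: "(norm (M *v x))\<^sup>2 = \<Delta> * (norm x)\<^sup>2"
    using x by (simp add: \<Delta>_def)
  \<comment> \<open>For \<open>u = 0\<close> the quotient is 0 by the convention on division, and
    both sides vanish.\<close>
  have \<rho>: "(norm (M *v u))\<^sup>2 = \<rho> * (norm u)\<^sup>2"
    by (cases "u = 0") (simp_all add: \<rho>_def)

  have xu: "x \<bullet> u = \<Delta> * (norm x)\<^sup>2"
    using inner_u[OF x_span] inner_g[of x] \<Delta> by (simp add: power2_norm_eq_inner)
  have uu: "(norm u)\<^sup>2 \<le> \<rho> * \<Delta> * (norm x)\<^sup>2"
  proof (cases "u = 0")
    case False
    have "(norm u)\<^sup>2 = (M *v u) \<bullet> (M *v x)"
      using inner_u[OF u_span] inner_g[of u] by (simp add: power2_norm_eq_inner)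
    also have "\<dots> \<le> norm (M *v u) * norm (M *v x)"
      by (rule norm_cauchy_schwarz)
    \<comment> \<open>Squaring lets both norms be expressed through \<rho> and \<Delta>; a factor
      \<open>(norm u)\<^sup>2\<close> then cancels.\<close>
    finally have "((norm u)\<^sup>2)\<^sup>2 \<le> (norm (M *v u) * norm (M *v x))\<^sup>2"
      by (rule power_mono) simp
    also have "\<dots> = (\<rho> * \<Delta> * (norm x)\<^sup>2) * (norm u)\<^sup>2"
      by (simp add: power_mult_distrib \<rho> \<Delta>)
    finally have "(norm u)\<^sup>2 * (norm u)\<^sup>2 \<le> (\<rho> * \<Delta> * (norm x)\<^sup>2) * (norm u)\<^sup>2"
      by (simp only: power2_eq_square[of "(norm u)\<^sup>2"])
    then show ?thesis
      using False by (simp only: mult_le_cancel_right) simp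
  qed (simp add: \<rho>_def)

  have "(norm (x - \<mu> *\<^sub>R u))\<^sup>2 = (norm x)\<^sup>2 - 2 * \<mu> * (x \<bullet> u) + \<mu>\<^sup>2 * (norm u)\<^sup>2"
    unfolding power2_norm_eq_inner
    by (simp add: inner_diff_left inner_diff_right inner_commute power2_eq_square
        right_diff_distrib)
  also have "\<dots> \<le> (norm x)\<^sup>2 - 2 * \<mu> * (\<Delta> * (norm x)\<^sup>2) + \<mu>\<^sup>2 * (\<rho> * \<Delta> * (norm x)\<^sup>2)"
    using mult_left_mono[OF uu, of "\<mu>\<^sup>2"] by (simp add: xu)
  also have "\<dots> = (1 - (2 - \<mu> * \<rho>) * \<mu> * \<Delta>) * (norm x)\<^sup>2"
    by (simp add: power2_eq_square algebra_simps)
  \<comment> \<open>The chain bounds a square from above, so the radicand is nonnegative and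
    \<open>sqrt\<close> is a genuine square root.\<close>
  finally have "norm (x - \<mu> *\<^sub>R u) \<le> sqrt ((1 - (2 - \<mu> * \<rho>) * \<mu> * \<Delta>) * (norm x)\<^sup>2)"
    by (rule real_le_rsqrt)
  then have projected: "norm (x - \<mu> *\<^sub>R u) \<le> sqrt (1 - (2 - \<mu> * \<rho>) * \<mu> * \<Delta>) * norm x"
    by (simp add: real_sqrt_mult)

  have "norm (M *v x) = sqrt \<Delta> * norm x"
    using x by (simp add: \<Delta>_def real_sqrt_divide)
  then have g_le: "norm g \<le> onorm ((*v) M) * (sqrt \<Delta> * norm x)"
    unfolding g_def by (metis norm_transpose_matrix_vector_le)
  have "norm w \<le> norm x + \<mu> * norm g"
    using norm_triangle_ineq4[of x "\<mu> *\<^sub>R g"] \<mu> by (simp add: w g_def)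
  also have "\<dots> \<le> norm x + \<mu> * (onorm ((*v) M) * (sqrt \<Delta> * norm x))"
    using mult_left_mono[OF g_le \<mu>] by simp
  also have "\<dots> = (1 + \<mu> * onorm ((*v) M) * sqrt \<Delta>) * norm x"
    by (simp add: algebra_simps)
  finally have w_le: "norm w \<le> (1 + \<mu> * onorm ((*v) M) * sqrt \<Delta>) * norm x" .

  have "x' \<bullet> w = x' \<bullet> (x - \<mu> *\<^sub>R u)"
    using inner_u[OF x'_span] by (simp add: w g_def inner_diff_right)
  also have "\<dots> \<le> norm x' * norm (x - \<mu> *\<^sub>R u)"
    by (rule norm_cauchy_schwarz)
  finally have x'w: "x' \<bullet> w \<le> norm x' * norm (x - \<mu> *\<^sub>R u)" .
  have "(norm (x' - w))\<^sup>2 \<le> ((1 + \<xi>) * norm w)\<^sup>2"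
    using near by (rule power_mono) simp
  \<comment> \<open>Since \<open>(1 + \<xi>)\<^sup>2 = 1 + e\<close>, the term
    \<open>(norm w)\<^sup>2\<close> split off here cancels the one in the expansion of
    \<open>(norm (x' - w))\<^sup>2\<close>.\<close>
  also have "\<dots> = (norm w)\<^sup>2 + (sqrt e * norm w)\<^sup>2"
    using e by (simp add: power_mult_distrib) (simp add: e_def power2_eq_square algebra_simps)
  finally have "(norm x')\<^sup>2 \<le> 2 * (x' \<bullet> w) + (sqrt e * norm w)\<^sup>2"
    by (simp add: power2_norm_eq_inner inner_diff_left inner_diff_right inner_commute)
  with x'w have "(norm x')\<^sup>2 \<le> 2 * norm x' * norm (x - \<mu> *\<^sub>R u) + (sqrt e * norm w)\<^sup>2"
    by linarith
  then have "norm x' \<le> 2 * norm (x - \<mu> *\<^sub>R u) + sqrt e * norm w"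
    by (rule le_of_square_le_linear) (use e in auto)
  also have "\<dots> \<le> 2 * (sqrt (1 - (2 - \<mu> * \<rho>) * \<mu> * \<Delta>) * norm x) +
      sqrt e * ((1 + \<mu> * onorm ((*v) M) * sqrt \<Delta>) * norm x)"
    using projected mult_left_mono[OF w_le, of "sqrt e"] e by simp
  finally show ?thesis
    by (simp add: e_def algebra_simps)
qed

text \<open>The contraction factor varies with the iteration, so the power is rendered both as the
  product of \<open>c 0\<close>, ..., \<open>c t\<close> and as a power of the largest of
  them.\<close>

theorem theorem10:
  fixes A :: "real ^ ('d::finite \<Rightarrow> 'n::finite) ^ 'm::finite"
    and b :: "real ^ 'm"
    and Xstar :: "('d, 'n) tensor"
    and T :: "('d, 'n) tensor \<Rightarrow> ('d, 'n) tensor"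
    and \<mu> \<xi> \<Delta> \<rho> c :: "nat \<Rightarrow> real"
    and \<Theta> :: "nat \<Rightarrow> 'm set"
    and \<sigma> :: "nat \<Rightarrow> 'k::finite \<Rightarrow> 'm"
    and X Y R :: "nat \<Rightarrow> ('d, 'n) tensor"
    and At :: "nat \<Rightarrow> real ^ ('d \<Rightarrow> 'n) ^ 'k"
    and res u :: "nat \<Rightarrow> real ^ ('d \<Rightarrow> 'n)"
    and r mtrim t :: nat
  assumes rank:
      "(has_hosvd_rank (\<lambda>_. r) Xstar \<and> (\<forall>Z. hosvd_rank_at_most (\<lambda>_. r) (T Z))) \<or>
       (has_cp_rank r Xstar \<and> (\<forall>Z. cp_rank_at_most r (T Z)))"
    and mtrim: "mtrim < CARD('m)"
    and measurements: "b = A *v Vec Xstar"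
    and step_sizes: "\<forall>s. 0 < \<mu> s"
    and algorithm: "trim_tiht A b mtrim T \<mu> \<Theta> \<sigma> X Y"
    and At: "\<forall>s. At s = trim_rows mtrim (\<sigma> s) A"
    and R: "\<forall>s. R s = X s - Xstar"
    and res: "\<forall>s. res s = Vec (R s)"
    and Delta: "\<forall>s. \<Delta> s = (norm (At s *v res s))\<^sup>2 / (norm (res s))\<^sup>2"
    and u: "\<forall>s. u s = orth_proj (span {res s, res (Suc s)}) (transpose (At s) *v (At s *v res s))"
    and rho: "\<forall>s. \<rho> s = (norm (At s *v u s))\<^sup>2 / (norm (u s))\<^sup>2"
    and nonzero: "\<forall>s\<le>t. res s \<noteq> 0 \<and> u s \<noteq> 0"
    and xi: "\<forall>s\<le>t. 0 \<le> \<xi> s \<and>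
               frob_norm (X (Suc s) - Y s) \<le> (1 + \<xi> s) * frob_norm (Y s - Xstar)"
    and factor: "\<forall>s. c s = 2 * sqrt (1 - (2 - \<mu> s * \<rho> s) * \<mu> s * \<Delta> s) +
                   sqrt (2 * \<xi> s + (\<xi> s)\<^sup>2) * (1 + \<mu> s * onorm ((*v) (At s)) * sqrt (\<Delta> s))"
  shows "frob_norm (R (Suc t)) \<le> (\<Prod>s\<le>t. c s) * frob_norm (R 0) \<and>
         frob_norm (R (Suc t)) \<le> (MAX s\<in>{..t}. c s) ^ (t + 1) * frob_norm (R 0)"
proof -
  have step: "norm (res (Suc s)) \<le> c s * norm (res s)" if s: "s \<le> t" for s
  proof -
    have Y: "Vec (Y s) = Vec (X s) + \<mu> s *\<^sub>R (transpose (At s) *v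
        (trim_rows mtrim (\<sigma> s) b - At s *v Vec (X s)))"
      using algorithm At by (simp add: trim_tiht_def Let_def)
    have "trim_rows mtrim (\<sigma> s) b - At s *v Vec (X s) = At s *v (Vec Xstar - Vec (X s))"
      using At measurements trim_rows_residual by metis
    then have w: "Vec (Y s) - Vec Xstar = res s - \<mu> s *\<^sub>R (transpose (At s) *v (At s *v res s))"
      using Y by (simp add: res R Vec_diff matrix_vector_mult_diff_distrib algebra_simps)
    have "norm (res (Suc s) - (Vec (Y s) - Vec Xstar)) \<le> (1 + \<xi> s) * norm (Vec (Y s) - Vec Xstar)"
      using xi s by (simp add: frob_norm_def res R Vec_diff)
    then show ?thesis
      using trimmed_step_contraction[OF _ _ _ w, of "\<xi> s" "res (Suc s)"] nonzero xi s step_sizes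
      by (simp add: factor rho u Delta less_imp_le)
  qed
  \<comment> \<open>The sign comes from the step bound itself: \<open>c s\<close> times a positive
    norm dominates a norm.\<close>
  have c_nonneg: "0 \<le> c s" if s: "s \<le> t" for s
  proof -
    have "0 \<le> c s * norm (res s)"
      using step[OF s] norm_ge_zero order_trans by blast
    then show ?thesis
      using nonzero s by (simp add: zero_le_mult_iff)
  qed
  \<comment> \<open>The induction stays below \<open>t\<close>, where nonzero residuals and the
    bounds with \<xi> are assumed.\<close>
  have "s \<le> t \<Longrightarrow> norm (res (Suc s)) \<le> (\<Prod>i\<le>s. c i) * norm (res 0)" for s
  proof (induction s)
    case 0
    then show ?case using step by simp
  next
    case (Suc s)
    have "norm (res (Suc (Suc s))) \<le> c (Suc s) * norm (res (Suc s))"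
      using step Suc.prems by blast
    also have "\<dots> \<le> c (Suc s) * ((\<Prod>i\<le>s. c i) * norm (res 0))"
      using Suc c_nonneg by (intro mult_left_mono) auto
    finally show ?case by (simp add: mult_ac)
  qed
  then have prod: "norm (res (Suc t)) \<le> (\<Prod>s\<le>t. c s) * norm (res 0)"
    by simp
  \<comment> \<open>The indices \<open>0\<close>, ..., \<open>t\<close> give \<open>t + 1\<close>
    nonnegative factors, each at most the maximum.\<close>
  have "(\<Prod>s\<le>t. c s) \<le> (\<Prod>s\<le>t. MAX s\<in>{..t}. c s)"
    using c_nonneg by (intro prod_mono) auto
  then have "(\<Prod>s\<le>t. c s) \<le> (MAX s\<in>{..t}. c s) ^ (t + 1)"
    by simp
  then have "(\<Prod>s\<le>t. c s) * norm (res 0) \<le> (MAX s\<in>{..t}. c s) ^ (t + 1) * norm (res 0)"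
    by (rule mult_right_mono) simp
  with prod show ?thesis
    by (auto simp: frob_norm_def res)
qed

end
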